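(* Let $s=\sigma+it$ with $\sigma$ real and $t>0$, and let $\bar s=\sigma-it$. Then $$2\Re\left\{\sum_{m_1=1}^{[t]}\sum_{m_2=1}^{[t]}\frac{1}{m_2^{\bar s}(m_1+m_2)^{s}}\right\}-\left(\sum_{m=1}^{[t]}\frac1{m^{s}}\right)\left(\sum_{m=1}^{[t]}\frac1{m^{\bar s}}\right)=-\sum_{m=1}^{[t]}\frac1{m^{2\sigma}}+2\Re\left\{\sum_{m=1}^{[t]}\sum_{n=[t]+1}^{[t]+m}\frac{1}{m^{\bar s}n^{s}}\right\}.$$
   Context: $[t]$ denotes the integer part of the positive number $t$. *)

theory Defs
  imports "HOL-Analysis.Analysis"
begin

end

theory Submission
  imports Defs
begin

text \<open>
  Put \<open>a m = m\<^sup>-\<^sup>s\<close> and \<open>N = [t]\<close>. Conjugating \<open>m\<^sup>-\<^sup>s\<close> replaces \<open>s\<close> by its conjugate, because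
  the base is a nonnegative real, so every term of both double sums is of the form
  \<open>cnj (a m) * a n\<close>; and \<open>\<bar>a m\<bar>\<^sup>2 = m\<^sup>-\<^sup>2\<^sup>\<sigma>\<close>. These two facts reduce the claim
  to an identity for an arbitrary complex sequence \<open>a\<close>, proved by comparing index regions in
  the \<open>(m, n)\<close> plane.

  With \<open>m = m\<^sub>2\<close> and \<open>n = m\<^sub>1 + m\<^sub>2\<close>, the double sum on the left runs over the parallelogram
  \<open>1 \<le> m \<le> N\<close>, \<open>m < n \<le> m + N\<close>. The line \<open>n = N\<close> cuts it into the triangle
  \<open>m < n \<le> N\<close> and the triangle \<open>N < n \<le> N + m\<close>
  (\<open>sum_parallelogram_split\<close>). The second triangle is the double sum on the right. Twice the real
  part of the first is the sum of the off-diagonal terms of the square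
  \<open>\<Sum>m = 1..N. \<Sum>n = 1..N. cnj (a m) * a n\<close>, because swapping \<open>m\<close> and \<open>n\<close> conjugates a term
  (\<open>cmod_sum_squared\<close>). Subtracting the product of the two single sums, which is the whole square,
  therefore leaves minus the diagonal \<open>\<Sum>m = 1..N. \<bar>a m\<bar>\<^sup>2\<close>.
\<close>

text \<open>
  Adjoining the index \<open>N + 1\<close> adds one new diagonal term and the cross terms
  \<open>2 Re (cnj (a m) * a (N + 1))\<close> with \<open>m \<le> N\<close>; these extend each row of the triangle
  by one entry.
\<close>
lemma cmod_sum_squared:
  fixes a :: "nat \<Rightarrow> complex"
  shows "(cmod (\<Sum>m = 1..N. a m))\<^sup>2 =
    (\<Sum>m = 1..N. (cmod (a m))\<^sup>2) + 2 * Re (\<Sum>m = 1..N. \<Sum>n = m + 1..N. cnj (a m) * a n)"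
proof (induction N)
  case 0
  show ?case by simp
next
  case (Suc N)
  define A where "A = (\<Sum>m = 1..N. a m)"
  define x where "x = a (Suc N)"
  have "(\<Sum>m = 1..Suc N. \<Sum>n = m + 1..Suc N. cnj (a m) * a n) =
      (\<Sum>m = 1..N. (\<Sum>n = m + 1..N. cnj (a m) * a n) + cnj (a m) * x)"
    by (simp add: x_def)
  also have "\<dots> = (\<Sum>m = 1..N. \<Sum>n = m + 1..N. cnj (a m) * a n) + cnj A * x"
    by (simp add: A_def sum.distrib sum_distrib_right)
  finally have triangle: "(\<Sum>m = 1..Suc N. \<Sum>n = m + 1..Suc N. cnj (a m) * a n) =
      (\<Sum>m = 1..N. \<Sum>n = m + 1..N. cnj (a m) * a n) + cnj A * x" .
  have "(cmod (A + x))\<^sup>2 = (cmod A)\<^sup>2 + (cmod x)\<^sup>2 + 2 * Re (cnj A * x)"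
    unfolding cmod_power2 by (simp add: power2_eq_square algebra_simps)
  moreover have "(\<Sum>m = 1..Suc N. a m) = A + x"
    by (simp add: A_def x_def)
  moreover have "(\<Sum>m = 1..Suc N. (cmod (a m))\<^sup>2) = (\<Sum>m = 1..N. (cmod (a m))\<^sup>2) + (cmod x)\<^sup>2"
    by (simp add: x_def)
  ultimately show ?case
    using Suc.IH triangle by (simp only: A_def plus_complex.sel distrib_left ac_simps)
qed

lemma sum_parallelogram_split:
  fixes f :: "nat \<Rightarrow> nat \<Rightarrow> 'a::comm_monoid_add"
  shows "(\<Sum>k = 1..N. \<Sum>m = 1..N. f m (k + m)) =
    (\<Sum>m = 1..N. \<Sum>n = m + 1..N. f m n) + (\<Sum>m = 1..N. \<Sum>n = N + 1..N + m. f m n)"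
proof -
  have "(\<Sum>k = 1..N. \<Sum>m = 1..N. f m (k + m)) = (\<Sum>m = 1..N. \<Sum>k = 1..N. f m (k + m))"
    by (rule sum.swap)
  also have "\<dots> = (\<Sum>m = 1..N. (\<Sum>n = m + 1..N. f m n) + (\<Sum>n = N + 1..N + m. f m n))"
  proof (rule sum.cong)
    fix m assume "m \<in> {1..N}"
    then have m: "m + 1 \<le> N + 1" by simp
    have "(\<Sum>k = 1..N. f m (k + m)) = (\<Sum>n = 1 + m..N + m. f m n)"
      by (rule sum.shift_bounds_cl_nat_ivl [symmetric])
    also have "\<dots> = (\<Sum>n = m + 1..N. f m n) + (\<Sum>n = N + 1..N + m. f m n)"
      using sum.ub_add_nat [OF m, of "f m" m] by (simp add: add.commute)
    finally show "(\<Sum>k = 1..N. f m (k + m)) =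
        (\<Sum>n = m + 1..N. f m n) + (\<Sum>n = N + 1..N + m. f m n)" .
  qed simp
  also have "\<dots> = (\<Sum>m = 1..N. \<Sum>n = m + 1..N. f m n) + (\<Sum>m = 1..N. \<Sum>n = N + 1..N + m. f m n)"
    by (rule sum.distrib)
  finally show ?thesis .
qed

theorem corollary3p1:
  fixes \<sigma> t :: real and s sbar :: complex
  assumes "t > 0"
    and "s = complex_of_real \<sigma> + \<i> * complex_of_real t"
    and "sbar = complex_of_real \<sigma> - \<i> * complex_of_real t"
  shows "complex_of_real (2 * Re (\<Sum>m1 = 1..nat \<lfloor>t\<rfloor>. \<Sum>m2 = 1..nat \<lfloor>t\<rfloor>.
            1 / ((of_nat m2 powr sbar) * (of_nat (m1 + m2) powr s))))
          - (\<Sum>m = 1..nat \<lfloor>t\<rfloor>. 1 / (of_nat m powr s)) * (\<Sum>m = 1..nat \<lfloor>t\<rfloor>. 1 / (of_nat m powr sbar))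
        = complex_of_real
            (- (\<Sum>m = 1..nat \<lfloor>t\<rfloor>. 1 / (real m powr (2 * \<sigma>)))
             + 2 * Re (\<Sum>m = 1..nat \<lfloor>t\<rfloor>. \<Sum>n = nat \<lfloor>t\<rfloor> + 1..nat \<lfloor>t\<rfloor> + m.
                 1 / ((of_nat m powr sbar) * (of_nat n powr s))))"
proof -
  define N where "N = nat \<lfloor>t\<rfloor>"
  define a :: "nat \<Rightarrow> complex" where "a = (\<lambda>m. 1 / of_nat m powr s)"
  have "sbar = cnj s"
    using assms(2,3) by simp
  then have cnj_a: "1 / of_nat m powr sbar = cnj (a m)" for m
    by (simp add: a_def cnj_powr)
  have prod: "1 / (of_nat m powr sbar * of_nat n powr s) = cnj (a m) * a n" for m n
    using cnj_a [of m] by (simp add: a_def)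
  have "Re s = \<sigma>"
    using assms(2) by simp
  then have "cmod (of_nat m powr s) = real m powr \<sigma>" for m
    using norm_powr_real_powr [of "of_nat m" s] by simp
  then have norm_a: "(cmod (a m))\<^sup>2 = 1 / real m powr (2 * \<sigma>)" for m
    by (simp add: a_def norm_divide power_divide power2_eq_square powr_add [symmetric])
  have "complex_of_real (2 * Re (\<Sum>k = 1..N. \<Sum>m = 1..N. cnj (a m) * a (k + m)))
      - (\<Sum>m = 1..N. a m) * cnj (\<Sum>m = 1..N. a m) =
      complex_of_real (- (\<Sum>m = 1..N. (cmod (a m))\<^sup>2)
        + 2 * Re (\<Sum>m = 1..N. \<Sum>n = N + 1..N + m. cnj (a m) * a n))"
    unfolding complex_norm_square [symmetric] cmod_sum_squared
      sum_parallelogram_split [where f = "\<lambda>m n. cnj (a m) * a n"]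
    by (simp only: of_real_diff [symmetric] plus_complex.sel) simp
  then show ?thesis
    unfolding N_def [symmetric] prod cnj_a norm_a cnj_sum by (simp only: a_def)
qed

end
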